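(* For every positive integer $n$, $|S_n(\alpha_1,\alpha_2,\tau)|=\binom{n}{2}+1$ in each of the following cases: (1) $\alpha_1=123$, $\alpha_2=231$, and $\tau\in S_4$ contains $123$ or $231$; (2) $\alpha_1=123$, $\alpha_2\in\{132,213\}$, and $\tau\in\{3412,4231\}$; (3) $(\alpha_1,\alpha_2,\tau)=(132,213,3412)$; (4) $\alpha_1=132$, $\alpha_2=231$, and $\tau\in\{1234,2134,3124,3214\}$; (5) $(\alpha_1,\alpha_2,\tau)=(213,312,2341)$; (6) $\alpha_1=213$, $\alpha_2=321$, and $\tau\in\{1324,2314\}$; (7) $(\alpha_1,\alpha_2,\tau)=(213,132,4321)$.
   Context: Permutations are written in one-line notation. A permutation $\sigma\in S_n$ contains $\pi\in S_m$ if there are indices $i_1<\dots<i_m$ such that for all $j<l$, $\sigma_{i_j}<\sigma_{i_l}$ iff $\pi_j<\pi_l$; otherwise $\sigma$ avoids $\pi$. $S_n(\pi^{(1)},\dots,\pi^{(r)})$ is the set of permutations in $S_n$ avoiding all the listed patterns. *)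

theory Defs
  imports "HOL-Combinatorics.Multiset_Permutations"
begin

text \<open>Permutations in one-line notation are lists; S_n is the set of lists that are
  arrangements of {1..n}.\<close>

definition Sn :: "nat \<Rightarrow> nat list set" where
  "Sn n = permutations_of_set {1..n}"

definition contains :: "nat list \<Rightarrow> nat list \<Rightarrow> bool" where
  "contains \<sigma> \<pi> \<longleftrightarrow>
     (\<exists>f :: nat \<Rightarrow> nat. strict_mono_on {..<length \<pi>} f
        \<and> (\<forall>j<length \<pi>. f j < length \<sigma>)
        \<and> (\<forall>j l. j < l \<and> l < length \<pi> \<longrightarrow>
              (\<sigma> ! f j < \<sigma> ! f l \<longleftrightarrow> \<pi> ! j < \<pi> ! l)))"

definition avoids :: "nat list \<Rightarrow> nat list \<Rightarrow> bool" where
  "avoids \<sigma> \<pi> \<longleftrightarrow> \<not> contains \<sigma> \<pi>"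

definition Av :: "nat \<Rightarrow> nat list list \<Rightarrow> nat list set" where
  "Av n ps = {\<sigma> \<in> Sn n. \<forall>\<pi>\<in>set ps. avoids \<sigma> \<pi>}"

end

theory Submission
  imports Defs "HOL-Library.Sublist"
begin

text \<open>
  Up to reversal and complement, every pattern set in the theorem contains 132 (in cases (1)
  and (6) \<open>\<tau>\<close> contains \<open>\<alpha>\<^sub>1\<close> or \<open>\<alpha>\<^sub>2\<close> and is redundant). A permutation of \<open>{1..n+1}\<close> avoids 132
  iff it has the form \<open>X' (n+1) Y\<close>, where \<open>Y\<close> is a 132-avoiding permutation of \<open>{1..k}\<close> and \<open>X'\<close> is a
  132-avoiding permutation of \<open>{1..n-k}\<close> shifted up by \<open>k\<close>. As all of \<open>X' (n+1)\<close> lies above \<open>Y\<close>,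
  an occurrence of a pattern splits it into a higher initial and a lower final part, found in \<open>X' (n+1)\<close> and
  in \<open>Y\<close> respectively. For the patterns at hand the resulting conditions on \<open>X\<close> and \<open>Y\<close> are again avoidance
  conditions, so the count is a sum over \<open>k\<close> of products of smaller counts, and each case
  becomes a simple recursion.
\<close>


section \<open>Pattern containment\<close>

text \<open>The recursion lets the simplifier decide order isomorphism of explicit lists. As in
  \<open>contains\<close>, an entry is compared only with later ones and only by \<open><\<close>,
  so a tie counts like a descent.\<close>

fun order_iso :: "nat list \<Rightarrow> nat list \<Rightarrow> bool" where
  "order_iso [] [] \<longleftrightarrow> True"
| "order_iso (x # xs) (y # ys) \<longleftrightarrow> list_all2 (\<lambda>a b. x < a \<longleftrightarrow> y < b) xs ys \<and> order_iso xs ys"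
| "order_iso _ _ \<longleftrightarrow> False"

lemma order_iso_conv_nth:
  "order_iso xs ys \<longleftrightarrow> length xs = length ys \<and>
     (\<forall>j l. j < l \<and> l < length ys \<longrightarrow> (xs ! j < xs ! l \<longleftrightarrow> ys ! j < ys ! l))"
proof (induction xs ys rule: order_iso.induct)
  case (2 x xs y ys)
  have "(\<forall>j l. j < l \<and> l < length (y # ys) \<longrightarrow>
           ((x # xs) ! j < (x # xs) ! l \<longleftrightarrow> (y # ys) ! j < (y # ys) ! l)) \<longleftrightarrow>
        (\<forall>l<length ys. x < xs ! l \<longleftrightarrow> y < ys ! l) \<and>
        (\<forall>j l. j < l \<and> l < length ys \<longrightarrow> (xs ! j < xs ! l \<longleftrightarrow> ys ! j < ys ! l))"
    (is "?L \<longleftrightarrow> ?R")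
  proof
    assume L: ?L
    show ?R
    proof (intro conjI allI impI)
      fix l assume "l < length ys"
      then show "x < xs ! l \<longleftrightarrow> y < ys ! l" using L[rule_format, of 0 "Suc l"] by simp
    next
      fix j l assume "j < l \<and> l < length ys"
      then show "xs ! j < xs ! l \<longleftrightarrow> ys ! j < ys ! l"
        using L[rule_format, of "Suc j" "Suc l"] by simp
    qed
  next
    assume ?R
    then show ?L by (auto simp: nth_Cons split: nat.splits)
  qed
  then show ?case using 2 by (auto simp: list_all2_conv_all_nth)
qed auto

lemma order_iso_length: "order_iso xs ys \<Longrightarrow> length xs = length ys"
  by (simp add: order_iso_conv_nth)

lemma order_iso_refl: "order_iso xs xs"
  by (simp add: order_iso_conv_nth)

lemma order_iso_sym: "order_iso xs ys \<Longrightarrow> order_iso ys xs"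
  by (simp add: order_iso_conv_nth)

lemma order_iso_trans: "order_iso xs ys \<Longrightarrow> order_iso ys zs \<Longrightarrow> order_iso xs zs"
  by (simp add: order_iso_conv_nth)

text \<open>The pairs of positions of a concatenation lie in the first part, in the second part, or
  across the cut. The three conjuncts cover these kinds.\<close>

lemma order_iso_append:
  assumes "length xs = length ys"
  shows "order_iso (xs @ xs') (ys @ ys') \<longleftrightarrow> order_iso xs ys \<and> order_iso xs' ys' \<and>
    list_all2 (\<lambda>x y. list_all2 (\<lambda>a b. x < a \<longleftrightarrow> y < b) xs' ys') xs ys"
  using assms
  by (induction xs ys rule: list_induct2)
     (auto simp: list_all2_append list_all2_lengthD dest: order_iso_length)

section \<open>Occurrences as subsequences\<close>

lemma set_subseq_subset: "subseq xs ys \<Longrightarrow> set xs \<subseteq> set ys"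
  by (induction rule: list_emb.induct) auto

text \<open>The bound \<open>b\<close> makes the induction on \<open>m\<close> work: the last index
  \<open>f m\<close> bounds all earlier ones and serves as the new \<open>b\<close>.\<close>

lemma subseq_map_nth:
  assumes "strict_mono_on {..<m} f" "\<forall>j<m. f j < b" "b \<le> length s"
  shows "subseq (map (\<lambda>j. s ! f j) [0..<m]) (take b s)"
  using assms
proof (induction m arbitrary: b)
  case (Suc m)
  have "subseq (map (\<lambda>j. s ! f j) [0..<m]) (take (f m) s)"
    using Suc.prems by (intro Suc.IH) (auto simp: strict_mono_on_def)
  moreover have "take (Suc (f m)) s = take (f m) s @ [s ! f m]"
    using Suc.prems by (intro take_Suc_conv_app_nth) auto
  moreover have "take b s = take (Suc (f m)) s @ take (b - Suc (f m)) (drop (Suc (f m)) s)"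
    using Suc.prems(2) take_add[of "Suc (f m)" "b - Suc (f m)" s]
      le_add_diff_inverse[of "Suc (f m)" b] by (simp add: Suc_le_eq del: diff_Suc_Suc add_Suc)
  ultimately have "subseq (map (\<lambda>j. s ! f j) [0..<m] @ [s ! f m]) (take b s)"
    using subseq_rev_drop_many[of "map (\<lambda>j. s ! f j) [0..<m] @ [s ! f m]" "take (f m) s @ [s ! f m]"]
    by simp
  then show ?case by simp
qed simp

lemma subseq_nthE:
  assumes "subseq ys s"
  shows "\<exists>f. strict_mono_on {..<length ys} f \<and> (\<forall>j<length ys. f j < length s \<and> ys ! j = s ! f j)"
  using assms
proof (induction rule: list_emb.induct)
  case (list_emb_Cons xs ys y)
  then obtain f where "strict_mono_on {..<length xs} f"
      "\<forall>j<length xs. f j < length ys \<and> xs ! j = ys ! f j" by blast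
  then show ?case by (intro exI[of _ "Suc \<circ> f"]) (auto simp: strict_mono_on_def)
next
  case (list_emb_Cons2 x y xs ys)
  then obtain f where "strict_mono_on {..<length xs} f"
      "\<forall>j<length xs. f j < length ys \<and> xs ! j = ys ! f j" by blast
  then show ?case using list_emb_Cons2(1)
    by (intro exI[of _ "case_nat 0 (Suc \<circ> f)"])
       (auto simp: strict_mono_on_def nth_Cons split: nat.splits)
qed (auto simp: strict_mono_on_def)

text \<open>Index embeddings are awkward to cut at a position of a list, whereas
  \<open>subseq\<close> distributes over append. Later proofs about concatenations therefore use
  this form.\<close>

lemma contains_conv_subseq: "contains s p \<longleftrightarrow> (\<exists>ys. subseq ys s \<and> order_iso ys p)"
proof
  assume "contains s p"
  then obtain f where f: "strict_mono_on {..<length p} f" "\<forall>j<length p. f j < length s"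
    "\<forall>j l. j < l \<and> l < length p \<longrightarrow> (s ! f j < s ! f l \<longleftrightarrow> p ! j < p ! l)"
    unfolding contains_def by blast
  have "subseq (map (\<lambda>j. s ! f j) [0..<length p]) s"
    using subseq_map_nth[OF f(1,2), of s] by simp
  moreover have "order_iso (map (\<lambda>j. s ! f j) [0..<length p]) p"
    using f(3) by (simp add: order_iso_conv_nth)
  ultimately show "\<exists>ys. subseq ys s \<and> order_iso ys p" by blast
next
  assume "\<exists>ys. subseq ys s \<and> order_iso ys p"
  then obtain ys where ys: "subseq ys s" "order_iso ys p" by blast
  then obtain f where "strict_mono_on {..<length ys} f"
      "\<forall>j<length ys. f j < length s \<and> ys ! j = s ! f j" using subseq_nthE by blast
  then show "contains s p"
    unfolding contains_def using ys(2) by (intro exI[of _ f]) (auto simp: order_iso_conv_nth)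
qed

lemma contains_order_iso: "order_iso p q \<Longrightarrow> contains s p \<longleftrightarrow> contains s q"
  unfolding contains_conv_subseq by (meson order_iso_sym order_iso_trans)

lemma contains_trans:
  assumes "contains s p" "contains p q"
  shows "contains s q"
proof -
  obtain f where f: "strict_mono_on {..<length p} f" "\<forall>j<length p. f j < length s"
    "\<forall>j l. j < l \<and> l < length p \<longrightarrow> (s ! f j < s ! f l \<longleftrightarrow> p ! j < p ! l)"
    using assms(1) unfolding contains_def by blast
  obtain g where g: "strict_mono_on {..<length q} g" "\<forall>j<length q. g j < length p"
    "\<forall>j l. j < l \<and> l < length q \<longrightarrow> (p ! g j < p ! g l \<longleftrightarrow> q ! j < q ! l)"
    using assms(2) unfolding contains_def by blast
  show ?thesis
    unfolding contains_def
    using f g by (intro exI[of _ "f \<circ> g"]) (auto simp: strict_mono_on_def)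
qed

lemma contains_Nil [simp]: "contains s []"
  by (simp add: contains_def strict_mono_on_def)

lemma contains_singleton [simp]: "contains s [x] \<longleftrightarrow> s \<noteq> []"
  by (cases s) (auto simp: contains_def strict_mono_on_def)

lemma contains_Nil_left: "contains [] p \<longleftrightarrow> p = []"
  by (auto simp: contains_def strict_mono_on_def)

lemma contains_map:
  assumes "\<And>x y. x \<in> set s \<Longrightarrow> y \<in> set s \<Longrightarrow> g x < g y \<longleftrightarrow> x < y"
  shows "contains (map g s) p \<longleftrightarrow> contains s p"
  unfolding contains_def
  by (intro arg_cong[of _ _ Ex] ext conj_cong refl) (auto simp: assms strict_mono_on_def)

section \<open>Containment in concatenations\<close>

text \<open>The index \<open>i\<close> is the number of entries of the occurrence that fall into
  \<open>A\<close>. The final conjunct compares entries across that cut.\<close>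

lemma contains_append:
  "contains (A @ B) p \<longleftrightarrow> (\<exists>i\<le>length p. \<exists>us vs. subseq us A \<and> subseq vs B \<and>
     order_iso us (take i p) \<and> order_iso vs (drop i p) \<and>
     list_all2 (\<lambda>x y. list_all2 (\<lambda>a b. x < a \<longleftrightarrow> y < b) vs (drop i p)) us (take i p))"
  (is "?L \<longleftrightarrow> ?R")
proof
  assume ?L
  then obtain us vs where uv: "subseq us A" "subseq vs B" "order_iso (us @ vs) p"
    unfolding contains_conv_subseq subseq_append_iff by blast
  let ?i = "length us"
  have "order_iso (us @ vs) (take ?i p @ drop ?i p)" using uv(3) by simp
  moreover have "?i \<le> length p" using order_iso_length[OF uv(3)] by simp
  ultimately show ?R using uv(1,2) by (subst (asm) order_iso_append) auto
next
  assume ?R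
  then obtain i us vs where "i \<le> length p" "subseq us A" "subseq vs B"
     "order_iso us (take i p)" "order_iso vs (drop i p)"
     "list_all2 (\<lambda>x y. list_all2 (\<lambda>a b. x < a \<longleftrightarrow> y < b) vs (drop i p)) us (take i p)" by blast
  then show ?L
    unfolding contains_conv_subseq
    by (intro exI[of _ "us @ vs"])
       (metis append_take_drop_id list_emb_append_mono order_iso_append order_iso_length)
qed

text \<open>All pairs across the cut are descents in \<open>A @ B\<close>, so the cross condition no
  longer depends on the chosen subsequences. It becomes a condition on the pattern alone, and the
  two parts can be matched independently.\<close>

lemma contains_skew:
  assumes "\<forall>a\<in>set A. \<forall>b\<in>set B. b < a"
  shows "contains (A @ B) p \<longleftrightarrow> (\<exists>i\<le>length p.
    (\<forall>x\<in>set (take i p). \<forall>y\<in>set (drop i p). \<not> x < y) \<and>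
    contains A (take i p) \<and> contains B (drop i p))"
proof -
  have "list_all2 (\<lambda>x y. list_all2 (\<lambda>a b. x < a \<longleftrightarrow> y < b) vs q') us q \<longleftrightarrow>
      (\<forall>x\<in>set q. \<forall>y\<in>set q'. \<not> x < y)"
    if "subseq us A" "subseq vs B" "order_iso us q" "order_iso vs q'" for us vs q q'
  proof -
    have "\<forall>a\<in>set us. \<forall>b\<in>set vs. \<not> a < b"
      using assms set_subseq_subset[OF that(1)] set_subseq_subset[OF that(2)] by fastforce
    then show ?thesis
      using order_iso_length[OF that(3)] order_iso_length[OF that(4)]
      unfolding list_all2_conv_all_nth by (auto simp: all_set_conv_all_nth)
  qed
  then have "(\<exists>us vs. subseq us A \<and> subseq vs B \<and> order_iso us q \<and> order_iso vs q' \<and>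
      list_all2 (\<lambda>x y. list_all2 (\<lambda>a b. x < a \<longleftrightarrow> y < b) vs q') us q) \<longleftrightarrow>
      (\<forall>x\<in>set q. \<forall>y\<in>set q'. \<not> x < y) \<and> contains A q \<and> contains B q'" for q q'
    unfolding contains_conv_subseq by blast
  then show ?thesis
    unfolding contains_append by simp
qed

text \<open>An occurrence either misses \<open>M\<close> or uses it as its last entry. In the latter
  case the last entry of the pattern must exceed all the others, and the rest is found in
  \<open>A\<close>.\<close>

lemma contains_snoc_max:
  assumes "\<forall>a\<in>set A. a < M"
  shows "contains (A @ [M]) p \<longleftrightarrow> contains A p \<or>
    (p \<noteq> [] \<and> (\<forall>x\<in>set (butlast p). x < last p) \<and> contains A (butlast p))"
  (is "?L \<longleftrightarrow> ?R")
proof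
  assume ?L
  then obtain us vs where uv: "subseq us A" "subseq vs [M]" "order_iso (us @ vs) p"
    unfolding contains_conv_subseq subseq_append_iff by blast
  show ?R
  proof (cases vs)
    case Nil
    then show ?thesis using uv by (auto simp: contains_conv_subseq)
  next
    case (Cons v vs')
    then have vs: "vs = [M]" using uv(2) by (auto split: if_splits)
    then obtain q x where p: "p = q @ [x]" "length us = length q"
      using order_iso_length[OF uv(3)] by (cases p rule: rev_cases) auto
    have "order_iso us q" "list_all2 (\<lambda>a y. a < M \<longleftrightarrow> y < x) us q"
      using uv(3) unfolding p vs by (auto simp: order_iso_append p(2))
    moreover have "\<forall>a\<in>set us. a < M"
      using assms set_subseq_subset[OF uv(1)] by blast
    ultimately show ?thesis using uv(1) p
      by (auto simp: contains_conv_subseq list_all2_conv_all_nth all_set_conv_all_nth)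
  qed
next
  assume ?R
  then show ?L
  proof
    assume "contains A p"
    then show ?L unfolding contains_conv_subseq using subseq_rev_drop_many by blast
  next
    assume *: "p \<noteq> [] \<and> (\<forall>x\<in>set (butlast p). x < last p) \<and> contains A (butlast p)"
    then obtain q x where p: "p = q @ [x]" by (cases p rule: rev_cases) auto
    with * obtain us where us: "subseq us A" "order_iso us q"
      by (auto simp: contains_conv_subseq)
    have "\<forall>a\<in>set us. a < M"
      using assms set_subseq_subset[OF us(1)] by blast
    then have "order_iso (us @ [M]) p"
      using us(2) * order_iso_length[OF us(2)] unfolding p
      by (auto simp: order_iso_append list_all2_conv_all_nth all_set_conv_all_nth)
    then show ?L using us(1) unfolding contains_conv_subseq by (metis subseq_append)
  qed
qed

section \<open>Containment under reversal and complement\<close>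

text \<open>Reversal exchanges the two sides of each comparison. Distinctness makes the reversed
  comparison the negation of the original one, on which \<open>s\<close> and \<open>p\<close>
  agree.\<close>

lemma contains_rev:
  assumes "contains s p" "distinct s" "distinct p"
  shows "contains (rev s) (rev p)"
proof -
  obtain ys where ys: "subseq ys s" "order_iso ys p"
    using assms(1) unfolding contains_conv_subseq by blast
  have d: "distinct ys" using ys(1) assms(2) subseqs_distinctD by fastforce
  have l: "length ys = length p" using ys(2) by (rule order_iso_length)
  have "order_iso (rev ys) (rev p)"
    unfolding order_iso_conv_nth
  proof (intro conjI allI impI)
    fix j k assume jk: "j < k \<and> k < length (rev p)"
    let ?m = "length p"
    have "?m - Suc k < ?m - Suc j \<and> ?m - Suc j < ?m" using jk by auto
    then have "ys ! (?m - Suc k) < ys ! (?m - Suc j) \<longleftrightarrow> p ! (?m - Suc k) < p ! (?m - Suc j)"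
      using ys(2) unfolding order_iso_conv_nth by blast
    moreover have "ys ! (?m - Suc k) \<noteq> ys ! (?m - Suc j)" "p ! (?m - Suc k) \<noteq> p ! (?m - Suc j)"
      using d assms(3) jk l by (auto simp: nth_eq_iff_index_eq)
    ultimately show "rev ys ! j < rev ys ! k \<longleftrightarrow> rev p ! j < rev p ! k"
      using jk l by (auto simp: rev_nth)
  qed (simp add: l)
  moreover have "subseq (rev ys) (rev s)"
    using ys(1) by (induction rule: list_emb.induct) (auto simp: subseq_rev_drop_many)
  ultimately show ?thesis unfolding contains_conv_subseq by blast
qed

lemma contains_rev_iff:
  "distinct s \<Longrightarrow> distinct p \<Longrightarrow> contains (rev s) (rev p) \<longleftrightarrow> contains s p"
  using contains_rev[of s p] contains_rev[of "rev s" "rev p"] by auto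

text \<open>Complementing negates each comparison between distinct entries, in \<open>s\<close> and
  in \<open>p\<close> alike, so the same index embeddings work on both sides.\<close>

lemma contains_complement:
  assumes "set s \<subseteq> {1..n}" "set p \<subseteq> {1..m}" "distinct s" "distinct p"
  shows "contains (map (\<lambda>x. Suc n - x) s) (map (\<lambda>x. Suc m - x) p) \<longleftrightarrow> contains s p"
proof -
  have flip: "Suc N - t ! i < Suc N - t ! j \<longleftrightarrow> \<not> t ! i < t ! j"
    if "set t \<subseteq> {1..N}" "distinct t" "i < length t" "j < length t" "i \<noteq> j" for N t i j
  proof -
    have "t ! i \<noteq> t ! j" using that by (simp add: nth_eq_iff_index_eq)
    moreover have "t ! i \<le> N" "t ! j \<le> N" using that(1,3,4) by (auto simp: subset_iff)
    ultimately show ?thesis by linarith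
  qed
  have "(\<forall>j l. j < l \<and> l < length p \<longrightarrow>
          (map (\<lambda>x. Suc n - x) s ! f j < map (\<lambda>x. Suc n - x) s ! f l \<longleftrightarrow>
           map (\<lambda>x. Suc m - x) p ! j < map (\<lambda>x. Suc m - x) p ! l)) \<longleftrightarrow>
        (\<forall>j l. j < l \<and> l < length p \<longrightarrow> (s ! f j < s ! f l \<longleftrightarrow> p ! j < p ! l))"
    if "strict_mono_on {..<length p} f" "\<forall>j<length p. f j < length s" for f
  proof (intro arg_cong[of _ _ All] ext imp_cong refl)
    fix j l assume jl: "j < l \<and> l < length p"
    moreover have "f j < f l" using that(1) jl by (auto simp: strict_mono_on_def)
    ultimately show "(map (\<lambda>x. Suc n - x) s ! f j < map (\<lambda>x. Suc n - x) s ! f l \<longleftrightarrow>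
           map (\<lambda>x. Suc m - x) p ! j < map (\<lambda>x. Suc m - x) p ! l) \<longleftrightarrow>
       (s ! f j < s ! f l \<longleftrightarrow> p ! j < p ! l)"
      using that(2) flip[OF assms(1,3), of "f j" "f l"] flip[OF assms(2,4), of j l] by auto
  qed
  then show ?thesis
    unfolding contains_def length_map by (intro ex_cong1) blast
qed

section \<open>Symmetries\<close>

lemma Sn_iff: "s \<in> Sn n \<longleftrightarrow> set s = {1..n} \<and> distinct s"
  by (auto simp: Sn_def dest: permutations_of_setD)

lemma length_Sn: "s \<in> Sn n \<Longrightarrow> length s = n"
  using distinct_card[of s] by (simp add: Sn_iff)

lemma finite_Av [simp]: "finite (Av n ps)"
  by (auto simp: Av_def Sn_def)

lemma card_Av_rev:
  assumes "\<forall>p\<in>set ps. distinct p"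
  shows "card (Av n (map rev ps)) = card (Av n ps)"
proof (rule sym, rule bij_betw_same_card[of rev], rule bij_betwI[where g = rev])
  show "rev \<in> Av n ps \<rightarrow> Av n (map rev ps)" "rev \<in> Av n (map rev ps) \<rightarrow> Av n ps"
    using assms contains_rev_iff[of "rev _"] 
    by (fastforce simp: Av_def avoids_def Sn_iff contains_rev_iff)+
qed auto

lemma card_Av_complement:
  assumes "\<forall>p\<in>set ps. p \<in> Sn (length p)"
  shows "card (Av n (map (\<lambda>p. map (\<lambda>x. Suc (length p) - x) p) ps)) = card (Av n ps)"
proof -
  \<comment> \<open>Complementing relative to the list's own length gives one map for permutations
    and patterns of all sizes, and an involution on each \<open>Sn k\<close>.\<close>
  define c where "c = (\<lambda>p. map (\<lambda>x. Suc (length p) - x) p)"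
  have c_c: "c (c s) = s" if "s \<in> Sn k" for s k
  proof -
    have "set s = {1..k}" "length s = k" using that by (simp_all add: Sn_iff length_Sn)
    then show ?thesis by (auto simp: c_def intro!: map_idI)
  qed
  have c_Sn: "c s \<in> Sn k" if "s \<in> Sn k" for s k
  proof -
    have s: "set s = {1..k}" "length s = k" "distinct s"
      using that by (simp_all add: Sn_iff length_Sn)
    have "(\<lambda>x. Suc k - x) ` {1..k} = {1..k}"
    proof
      show "{1..k} \<subseteq> (\<lambda>x. Suc k - x) ` {1..k}"
      proof
        fix x assume "x \<in> {1..k}"
        then have "x = Suc k - (Suc k - x)" "Suc k - x \<in> {1..k}" by auto
        then show "x \<in> (\<lambda>x. Suc k - x) ` {1..k}" by blast
      qed
    qed auto
    then show ?thesis
      using s by (auto simp: c_def Sn_iff distinct_map intro!: inj_onI)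
  qed
  have c_contains: "contains (c s) (c p) \<longleftrightarrow> contains s p" if "s \<in> Sn k" "p \<in> Sn m" for s p k m
    unfolding c_def using contains_complement[of s k p m] that length_Sn[OF that(1)] length_Sn[OF that(2)]
    by (simp add: Sn_iff)
  have "bij_betw c (Av n ps) (Av n (map c ps))"
  proof (rule bij_betwI[where g = c])
    show "c \<in> Av n ps \<rightarrow> Av n (map c ps)"
      using assms c_contains c_Sn by (fastforce simp: Av_def avoids_def)
    show "c \<in> Av n (map c ps) \<rightarrow> Av n ps"
      using assms c_contains[OF c_Sn] c_Sn by (fastforce simp: Av_def avoids_def c_contains c_c)
    show "c (c x) = x" if "x \<in> Av n ps" for x using that c_c by (auto simp: Av_def)
    show "c (c y) = y" if "y \<in> Av n (map c ps)" for y using that c_c by (auto simp: Av_def)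
  qed
  then show ?thesis unfolding c_def by (simp add: bij_betw_same_card)
qed

lemma card_Av_reverse_complement:
  assumes "\<forall>p\<in>set ps. p \<in> Sn (length p)"
  shows "card (Av n (map (\<lambda>p. map (\<lambda>x. Suc (length p) - x) (rev p)) ps)) = card (Av n ps)"
proof -
  have "card (Av n (map (\<lambda>p. map (\<lambda>x. Suc (length p) - x) p) (map rev ps))) =
      card (Av n (map rev ps))"
    using assms by (intro card_Av_complement) (auto simp: Sn_iff)
  also have "\<dots> = card (Av n ps)"
    using assms by (intro card_Av_rev) (auto simp: Sn_iff)
  finally show ?thesis by (simp add: comp_def)
qed

section \<open>Decomposition of 132-avoiding permutations\<close>

text \<open>This is the skew sum of \<open>X\<close> extended by a new final maximum with
  \<open>Y\<close>.\<close>

definition glue :: "nat list \<Rightarrow> nat list \<Rightarrow> nat list" where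
  "glue X Y = map (\<lambda>x. x + length Y) X @ [Suc (length X + length Y)] @ Y"

lemma glue_in_Sn:
  assumes "X \<in> Sn a" "Y \<in> Sn b"
  shows "glue X Y \<in> Sn (Suc (a + b))"
proof -
  have "(\<lambda>x. x + b) ` {1..a} = {Suc b..a + b}"
    using image_add_atLeastAtMost'[of b 1 a] by simp
  then show ?thesis
    using assms length_Sn[OF assms(1)] length_Sn[OF assms(2)]
    by (auto simp: glue_def Sn_iff distinct_map)
qed

text \<open>The cut before \<open>Y\<close> is handled by \<open>contains_skew\<close>, the maximum
  at the end of the front part by \<open>contains_snoc_max\<close>. For an explicit pattern the
  right-hand side unfolds to a finite disjunction.\<close>

lemma contains_glue:
  assumes "X \<in> Sn a" "Y \<in> Sn b"
  shows "contains (glue X Y) p \<longleftrightarrow> (\<exists>i\<le>length p.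
    (\<forall>x\<in>set (take i p). \<forall>y\<in>set (drop i p). \<not> x < y) \<and>
    (contains X (take i p) \<or> take i p \<noteq> [] \<and>
       (\<forall>x\<in>set (butlast (take i p)). x < last (take i p)) \<and> contains X (butlast (take i p))) \<and>
    contains Y (drop i p))"
proof -
  let ?X = "map (\<lambda>x. x + b) X"
  have X: "set X = {1..a}" "length X = a" and Y: "set Y = {1..b}" "length Y = b"
    using assms by (simp_all add: Sn_iff length_Sn)
  have g: "glue X Y = (?X @ [Suc (a + b)]) @ Y" using X Y by (simp add: glue_def)
  have "contains (?X @ [Suc (a + b)]) q \<longleftrightarrow> contains X q \<or>
      q \<noteq> [] \<and> (\<forall>x\<in>set (butlast q). x < last q) \<and> contains X (butlast q)" for q
    using X by (subst contains_snoc_max) (auto simp: contains_map)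
  then show ?thesis unfolding g using X Y by (subst contains_skew) auto
qed

text \<open>The maximum occurs exactly once, and it is the same on both sides because the total
  sizes agree. Its position determines both factors.\<close>

lemma glue_inject:
  assumes "X \<in> Sn a" "Y \<in> Sn b" "X' \<in> Sn a'" "Y' \<in> Sn b'" "a + b = a' + b'"
    "glue X Y = glue X' Y'"
  shows "X = X' \<and> Y = Y'"
proof -
  have l: "length X = a" "length Y = b" "length X' = a'" "length Y' = b'"
    using assms by (simp_all add: length_Sn)
  have "Suc (a + b) \<notin> set (map (\<lambda>x. x + b) X)" "Suc (a + b) \<notin> set Y"
    using assms by (auto simp: Sn_iff)
  then have e: "map (\<lambda>x. x + b) X = map (\<lambda>x. x + b') X'" "Y = Y'"
    using assms(5,6) by (auto simp: glue_def l append_Cons_eq_iff)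
  then have "b = b'" using l by simp
  then show ?thesis using e by (simp add: inj_map_eq_map inj_def)
qed

text \<open>An entry before the maximum and a larger entry after it would form 132 together with the
  maximum. So everything after the maximum is smaller than everything before it, and the two value
  sets are intervals.\<close>

lemma ex_glue:
  assumes s: "s \<in> Sn (Suc n)" and av: "avoids s [1,3,2]"
  shows "\<exists>k\<le>n. \<exists>X\<in>Sn (n - k). \<exists>Y\<in>Sn k. s = glue X Y"
proof -
  have "Suc n \<in> set s" using s by (simp add: Sn_iff)
  then obtain A B where AB: "s = A @ Suc n # B" by (meson split_list)
  have d: "distinct A" "distinct B" "set A \<inter> set B = {}" "Suc n \<notin> set A" "Suc n \<notin> set B"
    using s AB by (auto simp: Sn_iff)
  have "set A \<union> set B = set s - {Suc n}" using AB d by auto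
  also have "\<dots> = {1..Suc n} - {Suc n}" using s by (simp only: Sn_iff)
  also have "\<dots> = {1..n}" by auto
  finally have un: "set A \<union> set B = {1..n}" .
  have less: "b < a" if "a \<in> set A" "b \<in> set B" for a b
  proof (rule ccontr)
    assume "\<not> b < a"
    moreover have "a \<noteq> b" using that d by auto
    moreover have "b \<le> n" "a \<le> n" using that un by auto
    ultimately have "order_iso [a, Suc n, b] [1,3,2]" by simp
    moreover have "subseq ([a] @ [Suc n] @ [b]) (A @ [Suc n] @ B)"
      using that by (intro list_emb_append_mono) (auto simp: subseq_singleton_left)
    ultimately have "contains s [1,3,2]" using AB by (auto simp: contains_conv_subseq)
    then show False using av by (simp add: avoids_def)
  qed
  define k where "k = length B"
  have ck: "card (set B) = k" using d by (simp add: k_def distinct_card)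
  have B: "set B = {1..k}"
  proof (cases "B = []")
    case False
    define m where "m = Max (set B)"
    have m: "m \<in> set B" "\<forall>b\<in>set B. b \<le> m" using False by (simp_all add: m_def)
    \<comment> \<open>A value up to the maximum \<open>m\<close> of \<open>B\<close> cannot lie in
      \<open>A\<close>, whose entries all exceed \<open>m\<close>.\<close>
    have "set B = {1..m}"
    proof (intro equalityI subsetI)
      fix x assume "x \<in> {1..m}"
      moreover have "m \<le> n" using m un by auto
      ultimately have "x \<in> set A \<union> set B" using un by auto
      moreover have "x \<notin> set A" using less[OF _ m(1)] \<open>x \<in> {1..m}\<close> by fastforce
      ultimately show "x \<in> set B" by simp
    qed (use m un in auto)
    then show ?thesis using ck by simp
  qed (simp add: k_def)
  have kn: "k \<le> n" using ck un
    by (metis card_atLeastAtMost card_mono diff_Suc_1 finite_atLeastAtMost sup_ge2)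
  have A: "set A = {Suc k..n}"
  proof -
    have "set A = {1..n} - {1..k}" using un d(3) B by blast
    also have "\<dots> = {Suc k..n}" by auto
    finally show ?thesis .
  qed
  define X where "X = map (\<lambda>x. x - k) A"
  have "set X = {1..n - k}"
  proof -
    have "(\<lambda>x. x - k) ` {Suc k..n} = {1..n - k}"
    proof (intro equalityI subsetI)
      fix x assume "x \<in> {1..n - k}"
      then show "x \<in> (\<lambda>x. x - k) ` {Suc k..n}"
        by (intro image_eqI[of _ _ "x + k"]) auto
    qed auto
    then show ?thesis by (simp add: X_def A)
  qed
  moreover have "distinct X" using d(1) A by (auto simp: X_def distinct_map intro!: inj_onI)
  ultimately have "X \<in> Sn (n - k)" by (simp add: Sn_iff)
  moreover have "B \<in> Sn k" using B d by (simp add: Sn_iff)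
  moreover have "map (\<lambda>x. x + k) X = A" using A by (auto simp: X_def intro!: map_idI)
  then have "s = glue X B"
    using AB kn length_Sn[OF \<open>X \<in> Sn (n - k)\<close>] by (simp add: glue_def flip: k_def)
  ultimately show ?thesis using kn by blast
qed

text \<open>Peeling off index 0 unrolls the quantifier over cut positions once the pattern is
  explicit.\<close>

lemma ex_le_Suc_shift: "(\<exists>i\<le>Suc n. P i) \<longleftrightarrow> P 0 \<or> (\<exists>i\<le>n. P (Suc i))"
  by (metis Suc_le_mono not0_implies_Suc zero_le)

lemma all_le_Suc_shift: "(\<forall>i\<le>Suc n. P i) \<longleftrightarrow> P 0 \<and> (\<forall>i\<le>n. P (Suc i))"
  by (metis Suc_le_mono not0_implies_Suc zero_le)

text \<open>Neither 1|32 nor 13|2 is an admissible cut, since 1 is smaller than a later entry. As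
  132 does not end in its maximum, an occurrence lies entirely within \<open>X\<close> or within
  \<open>Y\<close>.\<close>

lemma avoids_132_glue:
  assumes "X \<in> Sn a" "Y \<in> Sn b"
  shows "avoids (glue X Y) [1,3,2] \<longleftrightarrow> avoids X [1,3,2] \<and> avoids Y [1,3,2]"
  unfolding avoids_def contains_glue[OF assms]
  by (auto simp: ex_le_Suc_shift)

lemma Av_0: "[] \<notin> set ps \<Longrightarrow> Av 0 ps = {[]}"
  by (auto simp: Av_def Sn_def avoids_def contains_Nil_left)

text \<open>Every nonempty list contains a pattern of length 1, so only the empty permutation can
  remain; it too is excluded when \<open>p\<close> is the empty pattern.\<close>

lemma card_Av_singleton: "card (Av n [p, [x]]) = (if n = 0 \<and> p \<noteq> [] then 1 else 0)"
proof -
  have "Av n [p, [x]] = (if n = 0 \<and> p \<noteq> [] then {[]} else {})"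
    by (auto simp: Av_def avoids_def Sn_iff contains_Nil_left)
  then show ?thesis by simp
qed

lemma Av_cong: "set ps = set qs \<Longrightarrow> Av n ps = Av n qs"
  by (simp add: Av_def)

text \<open>For fixed \<open>k\<close>, the other patterns must split into separate conditions on \<open>X\<close> and on \<open>Y\<close>.
  A factor can be forced to be empty with a pattern of length 1.\<close>
lemma card_Av_132_Suc:
  assumes "\<And>k X Y. k \<le> n \<Longrightarrow> X \<in> Sn (n - k) \<Longrightarrow> Y \<in> Sn k \<Longrightarrow>
    (X = [] \<longleftrightarrow> k = n) \<Longrightarrow> (Y = [] \<longleftrightarrow> k = 0) \<Longrightarrow>
    \<not> contains X [1,3,2] \<Longrightarrow> \<not> contains Y [1,3,2] \<Longrightarrow>
    (\<forall>p\<in>set ps. \<not> contains (glue X Y) p) \<longleftrightarrow>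
    (\<forall>p\<in>set (P k). \<not> contains X p) \<and> (\<forall>p\<in>set (Q k). \<not> contains Y p)"
  shows "card (Av (Suc n) ([1,3,2] # ps)) =
    (\<Sum>k\<le>n. card (Av (n - k) ([1,3,2] # P k)) * card (Av k ([1,3,2] # Q k)))"
proof -
  define F where "F = (\<lambda>k. Av (n - k) ([1,3,2] # P k) \<times> Av k ([1,3,2] # Q k))"
  define G where "G = (\<lambda>k. case_prod glue ` F k)"
  have cond: "glue X Y \<in> Av (Suc n) ([1,3,2] # ps) \<longleftrightarrow> (X, Y) \<in> F k"
    if "k \<le> n" "X \<in> Sn (n - k)" "Y \<in> Sn k" for k X Y
  proof -
    \<comment> \<open>These equivalences translate emptiness of a factor into a condition on
      \<open>k\<close>, on which \<open>P\<close> and \<open>Q\<close> may depend.\<close>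
    have "X = [] \<longleftrightarrow> k = n" "Y = [] \<longleftrightarrow> k = 0"
      using that length_Sn[OF that(2)] length_Sn[OF that(3)] by auto
    moreover have "glue X Y \<in> Sn (Suc n)" using glue_in_Sn[OF that(2,3)] that(1) by simp
    ultimately show ?thesis
      using assms[OF that] avoids_132_glue[OF that(2,3)] that by (auto simp: F_def Av_def avoids_def)
  qed
  have F_Sn: "X \<in> Sn (n - k) \<and> Y \<in> Sn k" if "(X, Y) \<in> F k" for k X Y
    using that by (auto simp: F_def Av_def)
  have "Av (Suc n) ([1,3,2] # ps) = (\<Union>k\<le>n. G k)"
  proof (intro equalityI subsetI)
    fix s assume s: "s \<in> Av (Suc n) ([1,3,2] # ps)"
    then obtain k X Y where "k \<le> n" "X \<in> Sn (n - k)" "Y \<in> Sn k" "s = glue X Y"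
      using ex_glue[of s n] by (auto simp: Av_def)
    then have "(X, Y) \<in> F k" using s cond by blast
    then show "s \<in> (\<Union>k\<le>n. G k)" using \<open>k \<le> n\<close> \<open>s = glue X Y\<close> by (force simp: G_def)
  next
    fix s assume "s \<in> (\<Union>k\<le>n. G k)"
    then obtain k X Y where "k \<le> n" "(X, Y) \<in> F k" "s = glue X Y" by (auto simp: G_def)
    then show "s \<in> Av (Suc n) ([1,3,2] # ps)" using cond F_Sn by blast
  qed
  moreover have "card (\<Union>k\<le>n. G k) = (\<Sum>k\<le>n. card (G k))"
  proof (rule card_UN_disjoint)
    show "\<forall>i\<in>{..n}. \<forall>j\<in>{..n}. i \<noteq> j \<longrightarrow> G i \<inter> G j = {}"
    proof (intro ballI impI equals0I)
      fix i j s assume ij: "i \<in> {..n}" "j \<in> {..n}" "i \<noteq> j" "s \<in> G i \<inter> G j"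
      then obtain X Y X' Y' where *: "(X, Y) \<in> F i" "(X', Y') \<in> F j" "glue X Y = glue X' Y'"
        by (auto simp: G_def)
      \<comment> \<open>The length of the second factor is \<open>k\<close>, so one permutation
        cannot arise for two values of \<open>k\<close>.\<close>
      have "Y = Y'"
        using glue_inject[of X "n - i" Y i X' "n - j" Y' j] F_Sn[OF *(1)] F_Sn[OF *(2)] *(3) ij
        by simp
      then show False using F_Sn[OF *(1)] F_Sn[OF *(2)] length_Sn ij(3) by blast
    qed
  qed (auto simp: G_def F_def)
  moreover have "card (G k) = card (Av (n - k) ([1,3,2] # P k)) * card (Av k ([1,3,2] # Q k))" for k
  proof -
    have "inj_on (case_prod glue) (F k)"
    proof (rule inj_onI)
      fix u v assume "u \<in> F k" "v \<in> F k" "case_prod glue u = case_prod glue v"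
      then show "u = v"
        using F_Sn[of "fst u" "snd u" k] F_Sn[of "fst v" "snd v" k]
          glue_inject[of "fst u" "n - k" "snd u" k "fst v" "n - k" "snd v" k]
        by (simp add: prod_eq_iff case_prod_beta)
    qed
    then show ?thesis unfolding G_def by (simp add: card_image F_def card_cartesian_product)
  qed
  ultimately show ?thesis by simp
qed

text \<open>The upper limit \<open>Suc m\<close> keeps the two ends distinct, so that neither term
  is counted twice.\<close>

lemma sum_atMost_ends:
  fixes f :: "nat \<Rightarrow> nat"
  assumes "\<And>k. 0 < k \<Longrightarrow> k \<le> m \<Longrightarrow> f k = 0"
  shows "(\<Sum>k\<le>Suc m. f k) = f 0 + f (Suc m)"
proof -
  have "(\<Sum>k\<le>Suc m. f k) = (\<Sum>k\<in>{0, Suc m}. f k)"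
    by (rule sum.mono_neutral_right) (use assms in auto)
  then show ?thesis by simp
qed

text \<open>The side conditions exclude the right-hand sides, so that these rules terminate as rewrite
  rules.\<close>
lemma contains_two:
  "a < b \<Longrightarrow> a \<noteq> 1 \<or> b \<noteq> 2 \<Longrightarrow> contains s [a, b] \<longleftrightarrow> contains s [1, 2]"
  "b < a \<Longrightarrow> a \<noteq> 2 \<or> b \<noteq> 1 \<Longrightarrow> contains s [a, b] \<longleftrightarrow> contains s [2, 1]"
  by (auto intro!: contains_order_iso)

text \<open>Here \<open>r\<close> is an occurrence of \<open>q\<close> inside \<open>p\<close>. With
  explicit lists both side conditions are decided by simplification.\<close>

lemma contains_patternI: "subseq r p \<Longrightarrow> order_iso r q \<Longrightarrow> contains s p \<Longrightarrow> contains s q"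
  using contains_conv_subseq contains_trans by blast

lemma Nil_Sn: "[] \<in> Sn 0"
  by (simp add: Sn_iff)

lemmas contains_glue_Nil = contains_glue[OF Nil_Sn] contains_glue[OF _ Nil_Sn]

lemmas glue_simps = contains_glue ex_le_Suc_shift all_le_Suc_shift contains_Nil_left

section \<open>Counting\<close>

text \<open>The maximum forms 21 with any entry of \<open>Y\<close>, so only \<open>k = 0\<close>
  contributes.\<close>

lemma card_Av_132_21: "card (Av n [[1,3,2], [2,1]]) = 1"
proof (induction n)
  case (Suc n)
  have "card (Av (Suc n) [[1,3,2], [2,1]]) =
      (\<Sum>k\<le>n. card (Av (n - k) [[1,3,2], [2,1]]) * card (Av k [[1,3,2], [1]]))"
    by (rule card_Av_132_Suc) (auto simp: glue_simps)
  also have "\<dots> = (\<Sum>k\<le>n. if k = 0 then 1 else 0)"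
    using Suc by (intro sum.cong) (auto simp: card_Av_singleton)
  finally show ?case by simp
qed (simp add: Av_0)

text \<open>Any entry of \<open>X\<close> forms 12 with the maximum, so only \<open>k = n\<close>
  contributes.\<close>

lemma card_Av_132_12: "card (Av n [[1,3,2], [1,2]]) = 1"
proof (induction n)
  case (Suc n)
  have "card (Av (Suc n) [[1,3,2], [1,2]]) =
      (\<Sum>k\<le>n. card (Av (n - k) [[1,3,2], [1]]) * card (Av k [[1,3,2], [1,2]]))"
    by (rule card_Av_132_Suc) (auto simp: glue_simps)
  also have "\<dots> = (\<Sum>k\<le>n. if k = n then 1 else 0)"
    using Suc by (intro sum.cong) (auto simp: card_Av_singleton)
  finally show ?case by simp
qed (simp add: Av_0)

text \<open>These implications between patterns discard the conditions on a factor that follow from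
  shorter patterns. The first list of each instance is the occurrence that justifies it.\<close>

lemmas contains_implied =
  contains_patternI[of "[3,2]" "[3,2,1]" "[2,1]", simplified]
  contains_patternI[of "[2,1]" "[2,1,3]" "[2,1]", simplified]
  contains_patternI[of "[1,3]" "[2,1,3]" "[1,2]", simplified]
  contains_patternI[of "[2,3]" "[2,3,1]" "[1,2]", simplified]
  contains_patternI[of "[3,1]" "[2,3,1]" "[2,1]", simplified]
  contains_patternI[of "[1,2]" "[1,2,3]" "[1,2]", simplified]
  contains_patternI[of "[1,2]" "[3,1,2]" "[1,2]", simplified]
  contains_patternI[of "[3,4]" "[3,4,1,2]" "[1,2]", simplified]
  contains_patternI[of "[3,1]" "[3,4,1,2]" "[2,1]", simplified]
  contains_patternI[of "[1,2,3]" "[1,2,3,4]" "[1,2,3]", simplified]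
  contains_patternI[of "[2,1,3]" "[2,1,3,4]" "[2,1,3]", simplified]
  contains_patternI[of "[3,1,2]" "[3,1,2,4]" "[3,1,2]", simplified]
  contains_patternI[of "[3,2,1]" "[3,2,1,4]" "[3,2,1]", simplified]
  contains_patternI[of "[2,3]" "[4,2,3,1]" "[1,2]", simplified]
  contains_patternI[of "[2,3]" "[4,2,3]" "[1,2]", simplified]
  contains_patternI[of "[3,2]" "[4,3,2]" "[2,1]", simplified]
  contains_patternI[of "[2,3,1]" "[4,2,3,1]" "[2,3,1]", simplified]
  contains_patternI[of "[3,2,1]" "[4,3,2,1]" "[3,2,1]", simplified]
  contains_patternI[of "[2,1]" "[4,3,2,1]" "[2,1]", simplified]

text \<open>The maximum followed by a 21 in \<open>Y\<close> is a 321, and so is a 21 in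
  \<open>X\<close> followed by any entry of \<open>Y\<close>. Hence each \<open>k > 0\<close>
  contributes 1, and \<open>k = 0\<close> contributes the previous count.\<close>

lemma card_Av_132_321: "card (Av n [[1,3,2], [3,2,1]]) = (n choose 2) + 1"
proof (induction n)
  case (Suc n)
  have "card (Av (Suc n) [[1,3,2], [3,2,1]]) =
      (\<Sum>k\<le>n. card (Av (n - k) ([1,3,2] # (if k = 0 then [[3,2,1]] else [[2,1]]))) *
        card (Av k [[1,3,2], [2,1]]))"
  proof (rule card_Av_132_Suc)
    fix k X Y assume *: "X \<in> Sn (n - k)" "Y \<in> Sn k" "Y = [] \<longleftrightarrow> k = 0"
    have "contains (glue X Y) [3,2,1] \<longleftrightarrow> contains X [3,2,1] \<or>
        Y \<noteq> [] \<and> contains X [2,1] \<or> contains Y [2,1]"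
      using contains_implied(1)[of Y]
      by (auto simp: contains_glue[OF *(1,2)] glue_simps contains_two)
    then show "(\<forall>p\<in>set [[3,2,1]]. \<not> contains (glue X Y) p) \<longleftrightarrow>
       (\<forall>p\<in>set (if k = 0 then [[3,2,1]] else [[2,1]]). \<not> contains X p) \<and>
       (\<forall>p\<in>set [[2,1]]. \<not> contains Y p)"
      using * contains_implied(1)[of X] by (cases "Y = []") (auto simp: contains_Nil_left)
  qed
  also have "\<dots> = (\<Sum>k\<le>n. if k = 0 then (n choose 2) + 1 else 1)"
    using Suc card_Av_132_21 by (intro sum.cong) auto
  also have "\<dots> = (Suc n choose 2) + 1"
    by (cases n) (simp_all add: sum.atMost_Suc_shift numeral_2_eq_2 del: sum.atMost_Suc)
  finally show ?case .
qed (simp add: Av_0 binomial_eq_0)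

text \<open>A 21 in \<open>X\<close> extends to 213 by the maximum, and a 21 in \<open>Y\<close>
  extends to 321. Both factors are thus unique, and each of the \<open>n + 1\<close> splits
  contributes 1.\<close>

lemma card_Av_132_213_321: "card (Av (Suc n) [[1,3,2], [2,1,3], [3,2,1]]) = Suc n"
proof -
  have "card (Av (Suc n) [[1,3,2], [2,1,3], [3,2,1]]) =
      (\<Sum>k\<le>n. card (Av (n - k) [[1,3,2], [2,1]]) * card (Av k [[1,3,2], [2,1]]))"
  proof (rule card_Av_132_Suc)
    fix k X Y assume *: "X \<in> Sn (n - k)" "Y \<in> Sn k"
    have "contains (glue X Y) [2,1,3] \<longleftrightarrow> contains X [2,1] \<or> contains Y [2,1,3]"
      by (auto simp: contains_glue[OF *] glue_simps contains_two dest: contains_implied)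
    moreover have "contains (glue X Y) [3,2,1] \<longleftrightarrow> contains X [3,2,1] \<or>
        Y \<noteq> [] \<and> contains X [2,1] \<or> contains Y [2,1]"
      by (auto simp: contains_glue[OF *] glue_simps contains_two dest: contains_implied)
    ultimately show "(\<forall>p\<in>set [[2,1,3], [3,2,1]]. \<not> contains (glue X Y) p) \<longleftrightarrow>
       (\<forall>p\<in>set [[2,1]]. \<not> contains X p) \<and> (\<forall>p\<in>set [[2,1]]. \<not> contains Y p)"
      by (auto dest: contains_implied)
  qed
  then show ?thesis by (simp only: card_Av_132_21) simp
qed

text \<open>Since 231 forces \<open>X\<close> or \<open>Y\<close> to be empty, the maximum is the last or the first entry.\<close>
lemma card_Av_132_231_Suc:
  assumes "[] \<noteq> q" "[] \<noteq> r" "p \<noteq> []"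
  assumes "\<And>X. X \<in> Sn (Suc m) \<Longrightarrow> X \<noteq> [] \<Longrightarrow> \<not> contains X [2,3,1] \<Longrightarrow>
    contains (glue X []) p \<longleftrightarrow> contains X q"
  assumes "\<And>Y. Y \<in> Sn (Suc m) \<Longrightarrow> Y \<noteq> [] \<Longrightarrow> \<not> contains Y [2,3,1] \<Longrightarrow>
    contains (glue [] Y) p \<longleftrightarrow> contains Y r"
  shows "card (Av (Suc (Suc m)) [[1,3,2], [2,3,1], p]) =
    card (Av (Suc m) [[1,3,2], [2,3,1], q]) + card (Av (Suc m) [[1,3,2], [2,3,1], r])"
proof -
  \<comment> \<open>For \<open>k = 0\<close> the factor \<open>Y\<close> is empty and
    \<open>q\<close> governs \<open>X\<close>. For \<open>k > 0\<close> the pattern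
    \<open>[1]\<close> forces \<open>X\<close> to be empty, which leaves only
    \<open>k = Suc m\<close>.\<close>
  have "card (Av (Suc (Suc m)) [[1,3,2], [2,3,1], p]) =
      (\<Sum>k\<le>Suc m. card (Av (Suc m - k) ([1,3,2] # (if k = 0 then [[2,3,1], q] else [[1]]))) *
        card (Av k [[1,3,2], [2,3,1], r]))"
  proof (rule card_Av_132_Suc)
    fix k X Y
    assume *: "k \<le> Suc m" "X \<in> Sn (Suc m - k)" "Y \<in> Sn k"
      "X = [] \<longleftrightarrow> k = Suc m" "Y = [] \<longleftrightarrow> k = 0"
    have "contains (glue X Y) [2,3,1] \<longleftrightarrow>
        contains X [2,3,1] \<or> contains Y [2,3,1] \<or> X \<noteq> [] \<and> Y \<noteq> []"
      by (simp add: contains_glue[OF *(2,3)] glue_simps contains_two)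
         (cases "X = []"; cases "Y = []"; simp add: contains_Nil_left)
    then show "(\<forall>p\<in>set [[2,3,1], p]. \<not> contains (glue X Y) p) \<longleftrightarrow>
       (\<forall>p\<in>set (if k = 0 then [[2,3,1], q] else [[1]]). \<not> contains X p) \<and>
       (\<forall>p\<in>set [[2,3,1], r]. \<not> contains Y p)"
      using * assms by (cases "k = 0"; cases "k = Suc m") (auto simp: contains_Nil_left)
  qed
  \<comment> \<open>At each end the empty factor counts 1; every term strictly between has a factor
    0.\<close>
  also have "\<dots> = card (Av (Suc m) [[1,3,2], [2,3,1], q]) + card (Av (Suc m) [[1,3,2], [2,3,1], r])"
    using assms(1,2) by (subst sum_atMost_ends) (auto simp: Av_0 card_Av_singleton)
  finally show ?thesis .
qed

lemma card_Av_132_231_12: "card (Av (Suc n) [[1,3,2], [2,3,1], [1,2]]) = 1"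
proof -
  have "Av (Suc n) [[1,3,2], [2,3,1], [1,2]] = Av (Suc n) [[1,3,2], [1,2]]"
    by (auto simp: Av_def avoids_def dest: contains_implied)
  then show ?thesis using card_Av_132_12[of "Suc n"] by simp
qed

lemma card_Av_132_231_21: "card (Av (Suc n) [[1,3,2], [2,3,1], [2,1]]) = 1"
proof -
  have "Av (Suc n) [[1,3,2], [2,3,1], [2,1]] = Av (Suc n) [[1,3,2], [2,1]]"
    by (auto simp: Av_def avoids_def dest: contains_implied)
  then show ?thesis using card_Av_132_21[of "Suc n"] by simp
qed

section \<open>Base cases and auxiliary sums\<close>

lemma contains_length: "contains s p \<Longrightarrow> length p \<le> length s"
  by (metis contains_conv_subseq list_emb_length order_iso_length)

lemma card_Av_1:
  assumes "\<forall>p\<in>set ps. 2 \<le> length p"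
  shows "card (Av (Suc 0) ps) = 1"
proof -
  have "s \<in> Sn (Suc 0) \<longleftrightarrow> s = [1]" for s
    by (simp add: Sn_def)
  then have "Av (Suc 0) ps = {[1]}"
    using assms by (force simp: Av_def avoids_def dest: contains_length)
  then show ?thesis by simp
qed

lemma contains_Cons_nonempty: "contains s (x # p) \<Longrightarrow> s \<noteq> []"
  by (auto simp: contains_Nil_left)

lemma sum_if_last: "(\<Sum>k\<le>n. if k = n then c else 1) = n + (c :: nat)"
proof -
  have "(\<Sum>k\<le>n. if k = n then c else 1) = (\<Sum>k<n. if k = n then c else 1) + c"
    by (simp flip: lessThan_Suc_atMost)
  also have "(\<Sum>k<n. if k = n then c else 1) = (\<Sum>k<n. 1)"
    by (intro sum.cong) auto
  finally show ?thesis by simp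
qed

text \<open>The terms with \<open>k > 0\<close> add up to a triangular number. The exceptional value
  at 0 counts the empty permutation.\<close>

lemma sum_if_zero: "(\<Sum>k\<le>n. if k = 0 then 1 else k) = (Suc n choose 2) + 1"
  by (induction n) (simp_all add: numeral_2_eq_2)

lemma choose_two_Suc: "Suc n choose 2 = n + (n choose 2)"
  by (simp add: numeral_2_eq_2)

section \<open>Classes avoiding 132 and 231\<close>

text \<open>A final maximum can serve as the 3, which leaves 12 to be avoided; an initial maximum
  takes part in no occurrence. So each step adds 1. The three counts that follow work alike, with an
  initial maximum serving as the 3 in 312 and 321.\<close>

lemma card_Av_132_231_123: "card (Av (Suc n) [[1,3,2], [2,3,1], [1,2,3]]) = Suc n"
proof (induction n)
  case (Suc n)
  have "card (Av (Suc (Suc n)) [[1,3,2], [2,3,1], [1,2,3]]) =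
      card (Av (Suc n) [[1,3,2], [2,3,1], [1,2]]) + card (Av (Suc n) [[1,3,2], [2,3,1], [1,2,3]])"
    by (rule card_Av_132_231_Suc)
       (auto simp: contains_glue_Nil glue_simps contains_two dest: contains_implied)
  then show ?case using Suc card_Av_132_231_12[of n] by simp
qed (simp add: card_Av_1)

lemma card_Av_132_231_213: "card (Av (Suc n) [[1,3,2], [2,3,1], [2,1,3]]) = Suc n"
proof (induction n)
  case (Suc n)
  have "card (Av (Suc (Suc n)) [[1,3,2], [2,3,1], [2,1,3]]) =
      card (Av (Suc n) [[1,3,2], [2,3,1], [2,1]]) + card (Av (Suc n) [[1,3,2], [2,3,1], [2,1,3]])"
    by (rule card_Av_132_231_Suc)
       (auto simp: contains_glue_Nil glue_simps contains_two dest: contains_implied)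
  then show ?case using Suc card_Av_132_231_21[of n] by simp
qed (simp add: card_Av_1)

lemma card_Av_132_231_312: "card (Av (Suc n) [[1,3,2], [2,3,1], [3,1,2]]) = Suc n"
proof (induction n)
  case (Suc n)
  have "card (Av (Suc (Suc n)) [[1,3,2], [2,3,1], [3,1,2]]) =
      card (Av (Suc n) [[1,3,2], [2,3,1], [3,1,2]]) + card (Av (Suc n) [[1,3,2], [2,3,1], [1,2]])"
    by (rule card_Av_132_231_Suc)
       (auto simp: contains_glue_Nil glue_simps contains_two dest: contains_implied)
  then show ?case using Suc card_Av_132_231_12[of n] by simp
qed (simp add: card_Av_1)

lemma card_Av_132_231_321: "card (Av (Suc n) [[1,3,2], [2,3,1], [3,2,1]]) = Suc n"
proof (induction n)
  case (Suc n)
  have "card (Av (Suc (Suc n)) [[1,3,2], [2,3,1], [3,2,1]]) =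
      card (Av (Suc n) [[1,3,2], [2,3,1], [3,2,1]]) + card (Av (Suc n) [[1,3,2], [2,3,1], [2,1]])"
    by (rule card_Av_132_231_Suc)
       (auto simp: contains_glue_Nil glue_simps contains_two dest: contains_implied)
  then show ?case using Suc card_Av_132_231_21[of n] by simp
qed (simp add: card_Av_1)

text \<open>This pattern and the three treated next end in 4. A final maximum reduces them to their
  first three entries, with count \<open>Suc n\<close>, and an initial maximum leaves them
  unchanged.\<close>

lemma card_Av_132_231_1234: "card (Av (Suc n) [[1,3,2], [2,3,1], [1,2,3,4]]) = (Suc n choose 2) + 1"
proof (induction n)
  case (Suc n)
  have "card (Av (Suc (Suc n)) [[1,3,2], [2,3,1], [1,2,3,4]]) =
      card (Av (Suc n) [[1,3,2], [2,3,1], [1,2,3]]) + card (Av (Suc n) [[1,3,2], [2,3,1], [1,2,3,4]])"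
    by (rule card_Av_132_231_Suc)
       (auto simp: contains_glue_Nil glue_simps contains_two dest: contains_implied)
  then show ?case using Suc card_Av_132_231_123[of n] by (simp add: choose_two_Suc[of "Suc n"])
qed (simp add: card_Av_1)

lemma card_Av_132_231_2134: "card (Av (Suc n) [[1,3,2], [2,3,1], [2,1,3,4]]) = (Suc n choose 2) + 1"
proof (induction n)
  case (Suc n)
  have "card (Av (Suc (Suc n)) [[1,3,2], [2,3,1], [2,1,3,4]]) =
      card (Av (Suc n) [[1,3,2], [2,3,1], [2,1,3]]) + card (Av (Suc n) [[1,3,2], [2,3,1], [2,1,3,4]])"
    by (rule card_Av_132_231_Suc)
       (auto simp: contains_glue_Nil glue_simps contains_two dest: contains_implied)
  then show ?case using Suc card_Av_132_231_213[of n] by (simp add: choose_two_Suc[of "Suc n"])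
qed (simp add: card_Av_1)

lemma card_Av_132_231_3124: "card (Av (Suc n) [[1,3,2], [2,3,1], [3,1,2,4]]) = (Suc n choose 2) + 1"
proof (induction n)
  case (Suc n)
  have "card (Av (Suc (Suc n)) [[1,3,2], [2,3,1], [3,1,2,4]]) =
      card (Av (Suc n) [[1,3,2], [2,3,1], [3,1,2]]) + card (Av (Suc n) [[1,3,2], [2,3,1], [3,1,2,4]])"
    by (rule card_Av_132_231_Suc)
       (auto simp: contains_glue_Nil glue_simps contains_two dest: contains_implied)
  then show ?case using Suc card_Av_132_231_312[of n] by (simp add: choose_two_Suc[of "Suc n"])
qed (simp add: card_Av_1)

lemma card_Av_132_231_3214: "card (Av (Suc n) [[1,3,2], [2,3,1], [3,2,1,4]]) = (Suc n choose 2) + 1"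
proof (induction n)
  case (Suc n)
  have "card (Av (Suc (Suc n)) [[1,3,2], [2,3,1], [3,2,1,4]]) =
      card (Av (Suc n) [[1,3,2], [2,3,1], [3,2,1]]) + card (Av (Suc n) [[1,3,2], [2,3,1], [3,2,1,4]])"
    by (rule card_Av_132_231_Suc)
       (auto simp: contains_glue_Nil glue_simps contains_two dest: contains_implied)
  then show ?case using Suc card_Av_132_231_321[of n] by (simp add: choose_two_Suc[of "Suc n"])
qed (simp add: card_Av_1)

section \<open>Classes avoiding 132 and one of 123 and 213\<close>

text \<open>By 123, \<open>X\<close> avoids 12. An entry of \<open>X\<close> and the maximum serve
  as 34, so a nonempty \<open>X\<close> forces \<open>Y\<close> to avoid 12, and each
  \<open>k < n\<close> contributes 1. For \<open>k = n\<close> the previous count appears.\<close>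

lemma card_Av_132_123_3412: "card (Av n [[1,3,2], [1,2,3], [3,4,1,2]]) = (n choose 2) + 1"
proof (induction n)
  case (Suc n)
  have "card (Av (Suc n) [[1,3,2], [1,2,3], [3,4,1,2]]) =
      (\<Sum>k\<le>n. card (Av (n - k) [[1,3,2], [1,2]]) *
        card (Av k ([1,3,2] # (if k = n then [[1,2,3], [3,4,1,2]] else [[1,2]]))))"
  proof (rule card_Av_132_Suc)
    fix k X Y assume *: "X \<in> Sn (n - k)" "Y \<in> Sn k" "X = [] \<longleftrightarrow> k = n"
    have "contains (glue X Y) [1,2,3] \<longleftrightarrow> contains X [1,2] \<or> contains Y [1,2,3]"
      by (auto simp: contains_glue[OF *(1,2)] glue_simps contains_two dest: contains_implied)
    moreover have "contains (glue X Y) [3,4,1,2] \<longleftrightarrow> X \<noteq> [] \<and> contains Y [1,2] \<or> contains Y [3,4,1,2]"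
      if "\<not> contains X [1,2]"
      using that
      by (auto simp: contains_glue[OF *(1,2)] glue_simps contains_two dest: contains_implied)
    ultimately show "(\<forall>p\<in>set [[1,2,3], [3,4,1,2]]. \<not> contains (glue X Y) p) \<longleftrightarrow>
       (\<forall>p\<in>set [[1,2]]. \<not> contains X p) \<and>
       (\<forall>p\<in>set (if k = n then [[1,2,3], [3,4,1,2]] else [[1,2]]). \<not> contains Y p)"
      using *(3) by (cases "X = []") (auto simp: contains_Nil_left dest: contains_implied)
  qed
  also have "\<dots> = (\<Sum>k\<le>n. if k = n then (n choose 2) + 1 else 1)"
    using Suc card_Av_132_12 by (intro sum.cong) auto
  also have "\<dots> = (Suc n choose 2) + 1"
    by (simp only: sum_if_last choose_two_Suc)
  finally show ?case .
qed (simp add: Av_0 binomial_eq_0)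

text \<open>The recursion is that for 123 and 3412, except that \<open>X\<close> must now avoid 21
  in place of 12.\<close>

lemma card_Av_132_213_3412: "card (Av n [[1,3,2], [2,1,3], [3,4,1,2]]) = (n choose 2) + 1"
proof (induction n)
  case (Suc n)
  have "card (Av (Suc n) [[1,3,2], [2,1,3], [3,4,1,2]]) =
      (\<Sum>k\<le>n. card (Av (n - k) [[1,3,2], [2,1]]) *
        card (Av k ([1,3,2] # (if k = n then [[2,1,3], [3,4,1,2]] else [[1,2]]))))"
  proof (rule card_Av_132_Suc)
    fix k X Y assume *: "X \<in> Sn (n - k)" "Y \<in> Sn k" "X = [] \<longleftrightarrow> k = n"
    have "contains (glue X Y) [2,1,3] \<longleftrightarrow> contains X [2,1] \<or> contains Y [2,1,3]"
      by (auto simp: contains_glue[OF *(1,2)] glue_simps contains_two dest: contains_implied)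
    moreover have "contains (glue X Y) [3,4,1,2] \<longleftrightarrow> X \<noteq> [] \<and> contains Y [1,2] \<or> contains Y [3,4,1,2]"
      if "\<not> contains X [2,1]"
      using that
      by (simp add: contains_glue[OF *(1,2)] glue_simps contains_two)
         (blast dest: contains_implied contains_Cons_nonempty)
    ultimately show "(\<forall>p\<in>set [[2,1,3], [3,4,1,2]]. \<not> contains (glue X Y) p) \<longleftrightarrow>
       (\<forall>p\<in>set [[2,1]]. \<not> contains X p) \<and>
       (\<forall>p\<in>set (if k = n then [[2,1,3], [3,4,1,2]] else [[1,2]]). \<not> contains Y p)"
      using *(3) by (cases "X = []") (auto simp: contains_Nil_left dest: contains_implied)
  qed
  also have "\<dots> = (\<Sum>k\<le>n. if k = n then (n choose 2) + 1 else 1)"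
    using Suc card_Av_132_21 card_Av_132_12 by (intro sum.cong) auto
  also have "\<dots> = (Suc n choose 2) + 1"
    by (simp only: sum_if_last choose_two_Suc)
  finally show ?case .
qed (simp add: Av_0 binomial_eq_0)

lemma card_Av_132_123_231: "card (Av (Suc n) [[1,3,2], [1,2,3], [2,3,1]]) = Suc n"
  by (subst card_Av_132_231_123[symmetric], rule arg_cong[of _ _ card], rule Av_cong) auto

text \<open>The maximum serves as the 4, so \<open>Y\<close> must avoid 231. The other cut, 423|1,
  needs a 12 in \<open>X\<close>, which 123 excludes.\<close>

lemma card_Av_132_123_4231: "card (Av n [[1,3,2], [1,2,3], [4,2,3,1]]) = (n choose 2) + 1"
proof (induction n)
  case (Suc n)
  have "card (Av (Suc n) [[1,3,2], [1,2,3], [4,2,3,1]]) =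
      (\<Sum>k\<le>n. card (Av (n - k) [[1,3,2], [1,2]]) * card (Av k [[1,3,2], [1,2,3], [2,3,1]]))"
  proof (rule card_Av_132_Suc)
    fix k X Y assume *: "X \<in> Sn (n - k)" "Y \<in> Sn k" "X = [] \<longleftrightarrow> k = n"
    have "contains (glue X Y) [1,2,3] \<longleftrightarrow> contains X [1,2] \<or> contains Y [1,2,3]"
      by (auto simp: contains_glue[OF *(1,2)] glue_simps contains_two dest: contains_implied)
    moreover have "contains (glue X Y) [4,2,3,1] \<longleftrightarrow> contains Y [2,3,1]" if "\<not> contains X [1,2]"
      using that
      by (auto simp: contains_glue[OF *(1,2)] glue_simps contains_two dest: contains_implied)
    ultimately show "(\<forall>p\<in>set [[1,2,3], [4,2,3,1]]. \<not> contains (glue X Y) p) \<longleftrightarrow>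
       (\<forall>p\<in>set [[1,2]]. \<not> contains X p) \<and>
       (\<forall>p\<in>set [[1,2,3], [2,3,1]]. \<not> contains Y p)"
      using *(3) by (cases "X = []") (auto simp: contains_Nil_left dest: contains_implied)
  qed
  also have "\<dots> = (\<Sum>k\<le>n. if k = 0 then 1 else k)"
  proof (rule sum.cong)
    fix k
    show "card (Av (n - k) [[1,3,2], [1,2]]) * card (Av k [[1,3,2], [1,2,3], [2,3,1]]) =
        (if k = 0 then 1 else k)"
      using card_Av_132_12[of "n - k"] card_Av_132_123_231[of "k - 1"]
      by (cases k) (simp_all add: Av_0)
  qed simp
  also have "\<dots> = (Suc n choose 2) + 1"
    by (rule sum_if_zero)
  finally show ?case .
qed (simp add: Av_0 binomial_eq_0)

text \<open>The maximum serves as the 4, so \<open>Y\<close> must avoid 321. Every other cut needs a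
  21 in \<open>X\<close>, which 213 excludes.\<close>

lemma card_Av_132_213_4321: "card (Av n [[1,3,2], [2,1,3], [4,3,2,1]]) = (n choose 2) + 1"
proof (induction n)
  case (Suc n)
  have "card (Av (Suc n) [[1,3,2], [2,1,3], [4,3,2,1]]) =
      (\<Sum>k\<le>n. card (Av (n - k) [[1,3,2], [2,1]]) * card (Av k [[1,3,2], [2,1,3], [3,2,1]]))"
  proof (rule card_Av_132_Suc)
    fix k X Y assume *: "X \<in> Sn (n - k)" "Y \<in> Sn k" "X = [] \<longleftrightarrow> k = n"
    have "contains (glue X Y) [2,1,3] \<longleftrightarrow> contains X [2,1] \<or> contains Y [2,1,3]"
      by (auto simp: contains_glue[OF *(1,2)] glue_simps contains_two dest: contains_implied)
    moreover have "contains (glue X Y) [4,3,2,1] \<longleftrightarrow> contains Y [3,2,1]" if "\<not> contains X [2,1]"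
      using that
      by (auto simp: contains_glue[OF *(1,2)] glue_simps contains_two dest: contains_implied)
    ultimately show "(\<forall>p\<in>set [[2,1,3], [4,3,2,1]]. \<not> contains (glue X Y) p) \<longleftrightarrow>
       (\<forall>p\<in>set [[2,1]]. \<not> contains X p) \<and>
       (\<forall>p\<in>set [[2,1,3], [3,2,1]]. \<not> contains Y p)"
      using *(3) by (cases "X = []") (auto simp: contains_Nil_left dest: contains_implied)
  qed
  also have "\<dots> = (\<Sum>k\<le>n. if k = 0 then 1 else k)"
  proof (rule sum.cong)
    fix k
    show "card (Av (n - k) [[1,3,2], [2,1]]) * card (Av k [[1,3,2], [2,1,3], [3,2,1]]) =
        (if k = 0 then 1 else k)"
      using card_Av_132_21[of "n - k"] card_Av_132_213_321[of "k - 1"]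
      by (cases k) (simp_all add: Av_0)
  qed simp
  also have "\<dots> = (Suc n choose 2) + 1"
    by (rule sum_if_zero)
  finally show ?case .
qed (simp add: Av_0 binomial_eq_0)

section \<open>Transfer by symmetry\<close>

lemmas Sn_numeral_simps = Sn_iff numeral_eq_Suc atLeastAtMostSuc_conv insert_commute

lemma card_Av_123_231: "card (Av n [[1,2,3], [2,3,1]]) = (n choose 2) + 1"
proof -
  have "card (Av n [[1,2,3], [2,3,1]]) = card (Av n (map rev [[1,3,2], [3,2,1]]))"
    by (intro arg_cong[of _ _ card] Av_cong) auto
  also have "\<dots> = card (Av n [[1,3,2], [3,2,1]])"
    by (rule card_Av_rev) simp
  finally show ?thesis using card_Av_132_321 by simp
qed

lemma card_Av_213_321: "card (Av n [[2,1,3], [3,2,1]]) = (n choose 2) + 1"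
  using card_Av_reverse_complement[of "[[1,3,2], [3,2,1]]" n] card_Av_132_321[of n]
  by (simp add: Sn_numeral_simps)

text \<open>Reverse complement takes 132 to 213 and fixes 123, 3412 and 4231, which also gives the
  next count.\<close>

lemma card_Av_213_123_3412: "card (Av n [[2,1,3], [1,2,3], [3,4,1,2]]) = (n choose 2) + 1"
  using card_Av_reverse_complement[of "[[1,3,2], [1,2,3], [3,4,1,2]]" n] card_Av_132_123_3412[of n]
  by (simp add: Sn_numeral_simps)

lemma card_Av_213_123_4231: "card (Av n [[2,1,3], [1,2,3], [4,2,3,1]]) = (n choose 2) + 1"
  using card_Av_reverse_complement[of "[[1,3,2], [1,2,3], [4,2,3,1]]" n] card_Av_132_123_4231[of n]
  by (simp add: Sn_numeral_simps)

lemma card_Av_312_213_2341: "card (Av (Suc n) [[3,1,2], [2,1,3], [2,3,4,1]]) = (Suc n choose 2) + 1"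
  using card_Av_complement[of "[[1,3,2], [2,3,1], [3,2,1,4]]" "Suc n"] card_Av_132_231_3214[of n]
  by (simp add: Sn_numeral_simps)

section \<open>Redundant patterns and the combined result\<close>

lemma contains_refl: "contains s s"
  using contains_conv_subseq order_iso_refl by blast

lemma Av_redundant:
  assumes "p \<in> set ps" "contains t p"
  shows "Av n (ps @ [t]) = Av n ps"
  using assms contains_trans by (auto simp: Av_def avoids_def)

theorem theorem3p7:
  fixes n :: nat
  assumes "n \<ge> 1"
  shows
   "(\<forall>\<tau>\<in>Sn 4. (contains \<tau> [1,2,3] \<or> contains \<tau> [2,3,1]) \<longrightarrow>
        card (Av n [[1,2,3], [2,3,1], \<tau>]) = (n choose 2) + 1)
  \<and> (\<forall>\<alpha>2\<in>{[1,3,2], [2,1,3]}. \<forall>\<tau>\<in>{[3,4,1,2], [4,2,3,1]}.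
        card (Av n [[1,2,3], \<alpha>2, \<tau>]) = (n choose 2) + 1)
  \<and> card (Av n [[1,3,2], [2,1,3], [3,4,1,2]]) = (n choose 2) + 1
  \<and> (\<forall>\<tau>\<in>{[1,2,3,4], [2,1,3,4], [3,1,2,4], [3,2,1,4]}.
        card (Av n [[1,3,2], [2,3,1], \<tau>]) = (n choose 2) + 1)
  \<and> card (Av n [[2,1,3], [3,1,2], [2,3,4,1]]) = (n choose 2) + 1
  \<and> (\<forall>\<tau>\<in>{[1,3,2,4], [2,3,1,4]}.
        card (Av n [[2,1,3], [3,2,1], \<tau>]) = (n choose 2) + 1)
  \<and> card (Av n [[2,1,3], [1,3,2], [4,3,2,1]]) = (n choose 2) + 1"
proof -
  \<comment> \<open>The counts for 132 and 231 are stated for \<open>Suc m\<close>.\<close>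
  obtain m where m: "n = Suc m" using assms by (cases n) auto
  have swap12: "Av n (p # q # ps) = Av n (q # p # ps)" for p q ps
    by (rule Av_cong) auto
  have "card (Av n [[1,2,3], [2,3,1], \<tau>]) = (n choose 2) + 1"
    if "contains \<tau> [1,2,3] \<or> contains \<tau> [2,3,1]" for \<tau>
    using that Av_redundant[of "[1,2,3]" "[[1,2,3], [2,3,1]]" \<tau> n]
      Av_redundant[of "[2,3,1]" "[[1,2,3], [2,3,1]]" \<tau> n] card_Av_123_231[of n] by auto
  moreover have "card (Av n [[1,2,3], \<alpha>, \<tau>]) = (n choose 2) + 1"
    if "\<alpha> \<in> {[1,3,2], [2,1,3]}" "\<tau> \<in> {[3,4,1,2], [4,2,3,1]}" for \<alpha> \<tau>
    unfolding swap12[of "[1,2,3]"]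
    using that card_Av_132_123_3412[of n] card_Av_132_123_4231[of n]
      card_Av_213_123_3412[of n] card_Av_213_123_4231[of n] by blast
  moreover have "card (Av n [[1,3,2], [2,1,3], [3,4,1,2]]) = (n choose 2) + 1"
    by (rule card_Av_132_213_3412)
  moreover have "card (Av n [[1,3,2], [2,3,1], \<tau>]) = (n choose 2) + 1"
    if "\<tau> \<in> {[1,2,3,4], [2,1,3,4], [3,1,2,4], [3,2,1,4]}" for \<tau>
    unfolding m using that card_Av_132_231_1234[of m] card_Av_132_231_2134[of m]
      card_Av_132_231_3124[of m] card_Av_132_231_3214[of m] by blast
  moreover have "card (Av n [[2,1,3], [3,1,2], [2,3,4,1]]) = (n choose 2) + 1"
    using card_Av_312_213_2341[of m] unfolding m[symmetric] swap12[of "[3,1,2]"] .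
  moreover have "card (Av n [[2,1,3], [3,2,1], \<tau>]) = (n choose 2) + 1"
    if "\<tau> \<in> {[1,3,2,4], [2,3,1,4]}" for \<tau>
  proof -
    \<comment> \<open>The pattern 213 occurs as 324 in 1324 and as 214 in 2314, so \<tau> is
      redundant.\<close>
    have "contains \<tau> [2,1,3]"
      using that contains_patternI[of "[3,2,4]" "[1,3,2,4]" "[2,1,3]" \<tau>]
        contains_patternI[of "[2,1,4]" "[2,3,1,4]" "[2,1,3]" \<tau>] contains_refl[of \<tau>] by auto
    then show ?thesis
      using Av_redundant[of "[2,1,3]" "[[2,1,3], [3,2,1]]" \<tau> n] card_Av_213_321[of n] by simp
  qed
  moreover have "card (Av n [[2,1,3], [1,3,2], [4,3,2,1]]) = (n choose 2) + 1"
    unfolding swap12[of "[2,1,3]"] by (rule card_Av_132_213_4321)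
  ultimately show ?thesis by blast
qed

end
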